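(* Operational equivalence $\simeq$ is a Hilbert–Post complete equational theory for the stack calculus: it is a consistent stack-theory, and every stack-theory that properly contains it is inconsistent.
   Context: The stack calculus. Fix a countably infinite set of stack variables $\alpha,\beta,\gamma,\ldots$. Expressions: stacks $\pi ::= \mathsf{nil}\mid\alpha\mid\mathsf{cdr}(\pi)\mid M::\pi$; terms $M ::= \mathsf{car}(\pi)\mid \mu\alpha.P$; processes $P ::= M\star\pi$ ($::$ right-associative, binding tighter than $\star$). $\mu\alpha$ binds $\alpha$; $E\{\pi/\alpha\}$ is capture-avoiding substitution; $\mathrm{FV}(E)$ the free variables. Reduction rules: $(\mu\alpha.P)\star\pi\to P\{\pi/\alpha\}$, $\mathsf{car}(M::\pi)\to M$, $\mathsf{cdr}(M::\pi)\to\pi$; $=_s$ is the equivalence closure of their contextual closure. $\mathsf{cdr}^n(\pi)$ is $n$-fold $\mathsf{cdr}$, $\mathsf{car}_n(\pi):=\mathsf{car}(\mathsf{cdr}^n(\pi))$. The canonical form of an expression is its normal form w.r.t. the $\mathsf{car},\mathsf{cdr}$ rules alone. Outer reduction (deterministic, no contextual closure): $M\to_o\mu\alpha.P\{\pi/\beta\}$ if $\mu\alpha.(\mu\beta.P)\star\pi$ is the canonical form of $M$. Outer normal forms (onf) are the non-$\to_o$-reducible terms, i.e. those of shape $\mu\alpha.H\star N_1::\cdots::N_m::\tau$ with $H$ equal to $\mathsf{car}_n(\beta)$ (proper) or $\mathsf{car}_n(\mathsf{nil})$ (improper) and $\tau$ equal to $\mathsf{cdr}^k(\gamma)$ or $\mathsf{cdr}^k(\mathsf{nil})$.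 Head contexts: $C[\cdot]::=[\cdot]\mid\mu\alpha.C[\cdot]\star\pi$. $M\simeq N$ iff for every head context $C[\cdot]$, $C[M]$ $\to_o$-reduces to a proper onf iff $C[N]$ does. A stack-theory is a set $\mathcal T$ of equalities between expressions that contains $=_s$ and is closed under context formation and replacement of $\mathcal T$-equal subexpressions (i.e. its induced relation $=_{\mathcal T}$ is a congruence containing $=_s$). $\mathcal T$ is inconsistent if for every pair of terms $M,N$ and every variable $\gamma\notin\mathrm{FV}(M)\cup\mathrm{FV}(N)$ we have $\mu\gamma.M\star\gamma =_{\mathcal T}\mu\gamma.N\star\gamma$, and consistent otherwise. Hilbert–Post complete means maximally consistent.
   Formalization: Shapes of outer normal forms are read on canonical forms, and a bare car_n(β) also counts as proper; otherwise car(β) and μα.car(β)⋆α would be separated and ≃ would not be maximal. ≃ is extended to processes and stacks by completing them to terms. *)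

theory Defs
  imports Main
begin

text \<open>
  Expressions are taken up to renaming of bound variables by means of a nameless
  representation: \<open>MuB\<close> binds index 0 of its body.  The free indices play the role of the
  (countably many) stack variables, and the named binder \<open>mu x P\<close> below abstracts the free
  variable \<open>x\<close>.  All notions of the calculus are stated with \<open>mu\<close>; the raw
  constructor \<open>MuB\<close> only occurs in the recursive functions on syntax.
\<close>

datatype stk = SNil | SVar nat | Cdr stk | SCons trm stk  (infixr ":::" 65)
  and trm = Car stk | MuB prc
  and prc = Cut trm stk  (infix "\<star>" 60)

primrec
  ren_stk :: "(nat \<Rightarrow> nat) \<Rightarrow> stk \<Rightarrow> stk" and
  ren_trm :: "(nat \<Rightarrow> nat) \<Rightarrow> trm \<Rightarrow> trm" and
  ren_prc :: "(nat \<Rightarrow> nat) \<Rightarrow> prc \<Rightarrow> prc"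
where
  "ren_stk f SNil = SNil"
| "ren_stk f (SVar x) = SVar (f x)"
| "ren_stk f (Cdr \<pi>) = Cdr (ren_stk f \<pi>)"
| "ren_stk f (M ::: \<pi>) = ren_trm f M ::: ren_stk f \<pi>"
| "ren_trm f (Car \<pi>) = Car (ren_stk f \<pi>)"
| "ren_trm f (MuB P) = MuB (ren_prc (case_nat 0 (\<lambda>x. Suc (f x))) P)"
| "ren_prc f (M \<star> \<pi>) = ren_trm f M \<star> ren_stk f \<pi>"

primrec
  sub_stk :: "(nat \<Rightarrow> stk) \<Rightarrow> stk \<Rightarrow> stk" and
  sub_trm :: "(nat \<Rightarrow> stk) \<Rightarrow> trm \<Rightarrow> trm" and
  sub_prc :: "(nat \<Rightarrow> stk) \<Rightarrow> prc \<Rightarrow> prc"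
where
  "sub_stk s SNil = SNil"
| "sub_stk s (SVar x) = s x"
| "sub_stk s (Cdr \<pi>) = Cdr (sub_stk s \<pi>)"
| "sub_stk s (M ::: \<pi>) = sub_trm s M ::: sub_stk s \<pi>"
| "sub_trm s (Car \<pi>) = Car (sub_stk s \<pi>)"
| "sub_trm s (MuB P) = MuB (sub_prc (case_nat (SVar 0) (\<lambda>x. ren_stk Suc (s x))) P)"
| "sub_prc s (M \<star> \<pi>) = sub_trm s M \<star> sub_stk s \<pi>"

primrec
  fv_stk :: "stk \<Rightarrow> nat set" and
  fv_trm :: "trm \<Rightarrow> nat set" and
  fv_prc :: "prc \<Rightarrow> nat set"
where
  "fv_stk SNil = {}"
| "fv_stk (SVar x) = {x}"
| "fv_stk (Cdr \<pi>) = fv_stk \<pi>"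
| "fv_stk (M ::: \<pi>) = fv_trm M \<union> fv_stk \<pi>"
| "fv_trm (Car \<pi>) = fv_stk \<pi>"
| "fv_trm (MuB P) = {x. Suc x \<in> fv_prc P}"
| "fv_prc (M \<star> \<pi>) = fv_trm M \<union> fv_stk \<pi>"

definition mu :: "nat \<Rightarrow> prc \<Rightarrow> trm" where
  "mu x P = MuB (ren_prc (\<lambda>y. if y = x then 0 else Suc y) P)"

definition subst :: "prc \<Rightarrow> stk \<Rightarrow> nat \<Rightarrow> prc"  ("_{_'/'/_}" [1000, 0, 0] 1000) where
  "P{\<pi>//x} = sub_prc (SVar(x := \<pi>)) P"


text \<open>
  The next facts confirm that \<open>mu\<close> is a binder in the usual sense: every abstraction is
  of the form \<open>mu x P\<close> with \<open>x\<close> any fresh variable, abstractions are identified up to renaming of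
  the bound variable, and substitution avoids capture.
\<close>

lemma ren_cong:
  "(\<And>x. x \<in> fv_stk \<pi> \<Longrightarrow> f x = g x) \<Longrightarrow> ren_stk f \<pi> = ren_stk g \<pi>"
  "(\<And>x. x \<in> fv_trm M \<Longrightarrow> f x = g x) \<Longrightarrow> ren_trm f M = ren_trm g M"
  "(\<And>x. x \<in> fv_prc P \<Longrightarrow> f x = g x) \<Longrightarrow> ren_prc f P = ren_prc g P"
proof (induction \<pi> and M and P arbitrary: f g and f g and f g)
  case (Cdr \<pi>)
  show ?case using Cdr.IH[of f g] Cdr.prems by simp
next
  case (SCons M \<pi>)
  show ?case using SCons.IH[of f g] SCons.prems by simp
next
  case (Car \<pi>)
  show ?case using Car.IH[of f g] Car.prems by simp
next
  case (MuB P)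
  have "ren_prc (case_nat 0 (\<lambda>x. Suc (f x))) P = ren_prc (case_nat 0 (\<lambda>x. Suc (g x))) P"
    using MuB.prems by (intro MuB.IH) (auto split: nat.split)
  then show ?case by simp
next
  case (Cut M \<pi>)
  show ?case using Cut.IH[of f g] Cut.prems by simp
qed simp_all

lemma sub_cong:
  "(\<And>x. x \<in> fv_stk \<pi> \<Longrightarrow> s x = t x) \<Longrightarrow> sub_stk s \<pi> = sub_stk t \<pi>"
  "(\<And>x. x \<in> fv_trm M \<Longrightarrow> s x = t x) \<Longrightarrow> sub_trm s M = sub_trm t M"
  "(\<And>x. x \<in> fv_prc P \<Longrightarrow> s x = t x) \<Longrightarrow> sub_prc s P = sub_prc t P"
proof (induction \<pi> and M and P arbitrary: s t and s t and s t)
  case (Cdr \<pi>)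
  show ?case using Cdr.IH[of s t] Cdr.prems by simp
next
  case (SCons M \<pi>)
  show ?case using SCons.IH[of s t] SCons.prems by simp
next
  case (Car \<pi>)
  show ?case using Car.IH[of s t] Car.prems by simp
next
  case (MuB P)
  have "sub_prc (case_nat (SVar 0) (\<lambda>x. ren_stk Suc (s x))) P = sub_prc (case_nat (SVar 0) (\<lambda>x. ren_stk Suc (t x))) P"
    using MuB.prems by (intro MuB.IH) (auto split: nat.split)
  then show ?case by simp
next
  case (Cut M \<pi>)
  show ?case using Cut.IH[of s t] Cut.prems by simp
qed simp_all

lemma ren_ren:
  "ren_stk f (ren_stk g \<pi>) = ren_stk (f \<circ> g) \<pi>"
  "ren_trm f (ren_trm g M) = ren_trm (f \<circ> g) M"
  "ren_prc f (ren_prc g P) = ren_prc (f \<circ> g) P"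
proof (induction \<pi> and M and P arbitrary: f g and f g and f g)
  case (MuB P)
  then show ?case by (auto split: nat.split intro!: ren_cong(3))
qed auto

lemma sub_ren:
  "sub_stk s (ren_stk g \<pi>) = sub_stk (s \<circ> g) \<pi>"
  "sub_trm s (ren_trm g M) = sub_trm (s \<circ> g) M"
  "sub_prc s (ren_prc g P) = sub_prc (s \<circ> g) P"
proof (induction \<pi> and M and P arbitrary: s g and s g and s g)
  case (MuB P)
  then show ?case by (auto split: nat.split intro!: sub_cong(3))
qed auto

lemma ren_sub:
  "ren_stk f (sub_stk s \<pi>) = sub_stk (\<lambda>x. ren_stk f (s x)) \<pi>"
  "ren_trm f (sub_trm s M) = sub_trm (\<lambda>x. ren_stk f (s x)) M"
  "ren_prc f (sub_prc s P) = sub_prc (\<lambda>x. ren_stk f (s x)) P"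
proof (induction \<pi> and M and P arbitrary: s f and s f and s f)
  case (MuB P)
  then show ?case
    by (auto split: nat.split simp: ren_ren comp_def intro!: sub_cong(3))
qed auto

lemma ren_as_sub:
  "ren_stk f \<pi> = sub_stk (SVar \<circ> f) \<pi>"
  "ren_trm f M = sub_trm (SVar \<circ> f) M"
  "ren_prc f P = sub_prc (SVar \<circ> f) P"
proof (induction \<pi> and M and P arbitrary: f and f and f)
  case (MuB P)
  then show ?case by (auto split: nat.split intro!: sub_cong(3))
qed auto

lemma ren_id:
  "ren_stk id \<pi> = \<pi>" "ren_trm id M = M" "ren_prc id P = P"
proof (induction \<pi> and M and P)
  case (MuB P)
  have "case_nat 0 (\<lambda>x. Suc (id x)) = id" by (auto split: nat.split)
  then show ?case by (simp only: ren_trm.simps MuB)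
qed auto

lemma fv_ren:
  "fv_stk (ren_stk f \<pi>) = f ` fv_stk \<pi>"
  "fv_trm (ren_trm f M) = f ` fv_trm M"
  "fv_prc (ren_prc f P) = f ` fv_prc P"
proof (induction \<pi> and M and P arbitrary: f and f and f)
  case (MuB P)
  have "Suc x \<in> case_nat 0 (\<lambda>x. Suc (f x)) ` A \<longleftrightarrow> x \<in> f ` {x. Suc x \<in> A}" for x A
  proof -
    have "Suc x = case_nat 0 (\<lambda>x. Suc (f x)) z \<longleftrightarrow> (\<exists>y. z = Suc y \<and> x = f y)" for z
      by (cases z) auto
    then show ?thesis by (auto simp: image_iff)
  qed
  then show ?case by (simp only: fv_trm.simps ren_trm.simps MuB) auto
qed auto

lemma fv_mu: "fv_trm (mu x P) = fv_prc P - {x}"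
proof -
  have "Suc z = (if y = x then 0 else Suc y) \<longleftrightarrow> y = z \<and> z \<noteq> x" for y z by auto
  then show ?thesis by (auto simp: mu_def fv_ren image_iff)
qed

lemma MuB_eq_mu:
  assumes "x \<notin> fv_trm (MuB Q)"
  shows "\<exists>P. MuB Q = mu x P"
proof
  have "ren_prc ((\<lambda>y. if y = x then 0 else Suc y) \<circ> case_nat x (\<lambda>y. y)) Q = ren_prc id Q"
    using assms by (intro ren_cong) (auto split: nat.splits)
  then show "MuB Q = mu x (ren_prc (case_nat x (\<lambda>y. y)) Q)"
    by (simp add: mu_def ren_ren ren_id)
qed

lemma mu_alpha:
  assumes "y \<notin> fv_prc P - {x}"
  shows "mu x P = mu y (P{SVar y//x})"
  using assms unfolding mu_def subst_def ren_sub ren_as_sub(3)[of _ P]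
  by (auto intro!: sub_cong(3))

lemma subst_mu:
  assumes "y \<noteq> x" "y \<notin> fv_stk \<pi>"
  shows "sub_trm (SVar(x := \<pi>)) (mu y P) = mu y (P{\<pi>//x})"
proof -
  have "ren_stk Suc \<pi> = ren_stk (\<lambda>z. if z = y then 0 else Suc z) \<pi>"
    using assms by (intro ren_cong(1)) auto
  with assms show ?thesis
    by (auto simp: mu_def subst_def ren_sub sub_ren intro!: sub_cong(3))
qed

text \<open>
  Relations between expressions are relations on the disjoint sum of the three syntactic
  categories.
\<close>

datatype expr = Stk stk | Trm trm | Prc prc

inductive_set compat :: "expr rel \<Rightarrow> expr rel" for R :: "expr rel" where
  base: "(E, F) \<in> R \<Longrightarrow> (E, F) \<in> compat R"
| Cdr: "(Stk \<pi>, Stk \<rho>) \<in> compat R \<Longrightarrow> (Stk (Cdr \<pi>), Stk (Cdr \<rho>)) \<in> compat R"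
| SCons1: "(Trm M, Trm N) \<in> compat R \<Longrightarrow> (Stk (M ::: \<pi>), Stk (N ::: \<pi>)) \<in> compat R"
| SCons2: "(Stk \<pi>, Stk \<rho>) \<in> compat R \<Longrightarrow> (Stk (M ::: \<pi>), Stk (M ::: \<rho>)) \<in> compat R"
| Car: "(Stk \<pi>, Stk \<rho>) \<in> compat R \<Longrightarrow> (Trm (Car \<pi>), Trm (Car \<rho>)) \<in> compat R"
| mu: "(Prc P, Prc Q) \<in> compat R \<Longrightarrow> (Trm (mu \<alpha> P), Trm (mu \<alpha> Q)) \<in> compat R"
| Cut1: "(Trm M, Trm N) \<in> compat R \<Longrightarrow> (Prc (M \<star> \<pi>), Prc (N \<star> \<pi>)) \<in> compat R"
| Cut2: "(Stk \<pi>, Stk \<rho>) \<in> compat R \<Longrightarrow> (Prc (M \<star> \<pi>), Prc (M \<star> \<rho>)) \<in> compat R"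

definition mu_rule :: "expr rel" where
  "mu_rule = {(Prc (mu \<alpha> P \<star> \<pi>), Prc (P{\<pi>//\<alpha>})) | \<alpha> P \<pi>. True}"

definition carcdr_rules :: "expr rel" where
  "carcdr_rules = {(Trm (Car (M ::: \<pi>)), Trm M) | M \<pi>. True}
                \<union> {(Stk (Cdr (M ::: \<pi>)), Stk \<pi>) | M \<pi>. True}"

definition eq_s :: "expr rel" where
  "eq_s = (let R = compat (mu_rule \<union> carcdr_rules) in (R \<union> R\<inverse>)\<^sup>*)"

definition canonical_form :: "expr \<Rightarrow> expr \<Rightarrow> bool" where
  "canonical_form E F \<longleftrightarrow> (E, F) \<in> (compat carcdr_rules)\<^sup>* \<and> F \<notin> Domain (compat carcdr_rules)"

definition car_n :: "nat \<Rightarrow> stk \<Rightarrow> trm" where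
  "car_n n \<pi> = Car ((Cdr ^^ n) \<pi>)"

inductive outer :: "trm \<Rightarrow> trm \<Rightarrow> bool"  (infix "\<rightarrow>\<^sub>o" 50) where
  "canonical_form (Trm M) (Trm (mu \<alpha> (mu \<beta> P \<star> \<pi>))) \<Longrightarrow> M \<rightarrow>\<^sub>o mu \<alpha> (P{\<pi>//\<beta>})"

definition onf :: "trm \<Rightarrow> bool" where
  "onf M \<longleftrightarrow> \<not> (\<exists>N. M \<rightarrow>\<^sub>o N)"

text \<open>
  The shape of an outer normal form is that of its canonical form.  The irreducible terms
  also include those whose canonical form is a bare head \<open>car_n n \<pi>\<close>, not placed under any
  \<open>mu\<close>; they are classified by their head as well.
\<close>

definition proper_onf :: "trm \<Rightarrow> bool" where
  "proper_onf M \<longleftrightarrow> onf M \<and>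
     (\<exists>n \<beta>. canonical_form (Trm M) (Trm (car_n n (SVar \<beta>))) \<or>
        (\<exists>\<alpha> Ns k \<tau>. (\<tau> = SNil \<or> (\<exists>\<gamma>. \<tau> = SVar \<gamma>)) \<and>
           canonical_form (Trm M)
             (Trm (mu \<alpha> (car_n n (SVar \<beta>) \<star> foldr (:::) Ns ((Cdr ^^ k) \<tau>))))))"

datatype head_ctx = Hole | HMu nat head_ctx stk

text \<open>Filling the hole may capture free variables of the inserted term.\<close>

primrec fill :: "head_ctx \<Rightarrow> trm \<Rightarrow> trm" where
  "fill Hole M = M"
| "fill (HMu \<alpha> C \<pi>) M = mu \<alpha> (fill C M \<star> \<pi>)"

definition has_proper_onf :: "trm \<Rightarrow> bool" where
  "has_proper_onf M \<longleftrightarrow> (\<exists>N. outer\<^sup>*\<^sup>* M N \<and> proper_onf N)"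

definition op_equiv :: "trm \<Rightarrow> trm \<Rightarrow> bool"  (infix "\<simeq>" 50) where
  "M \<simeq> N \<longleftrightarrow> (\<forall>C. has_proper_onf (fill C M) \<longleftrightarrow> has_proper_onf (fill C N))"

text \<open>
  Operational equivalence as a set of equalities between expressions of all three
  categories: processes and stacks are compared after completing them to terms.
\<close>

definition op_theory :: "expr rel" where
  "op_theory =
     {(Trm M, Trm N) | M N. M \<simeq> N}
   \<union> {(Prc P, Prc Q) | P Q. \<forall>\<alpha>. mu \<alpha> P \<simeq> mu \<alpha> Q}
   \<union> {(Stk \<pi>, Stk \<rho>) | \<pi> \<rho>. \<forall>\<alpha> M. mu \<alpha> (M \<star> \<pi>) \<simeq> mu \<alpha> (M \<star> \<rho>)}"

text \<open>Equalities only make sense between expressions of the same syntactic category.\<close>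

definition well_sorted :: "expr rel \<Rightarrow> bool" where
  "well_sorted T \<longleftrightarrow> T \<subseteq> range Stk \<times> range Stk \<union> range Trm \<times> range Trm \<union> range Prc \<times> range Prc"

definition stack_theory :: "expr rel \<Rightarrow> bool" where
  "stack_theory T \<longleftrightarrow> well_sorted T \<and> equiv UNIV T \<and> eq_s \<subseteq> T \<and> compat T \<subseteq> T"

definition inconsistent :: "expr rel \<Rightarrow> bool" where
  "inconsistent T \<longleftrightarrow>
     (\<forall>M N \<gamma>. \<gamma> \<notin> fv_trm M \<union> fv_trm N \<longrightarrow>
        (Trm (mu \<gamma> (M \<star> SVar \<gamma>)), Trm (mu \<gamma> (N \<star> SVar \<gamma>))) \<in> T)"

definition hilbert_post_complete :: "expr rel \<Rightarrow> bool" where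
  "hilbert_post_complete T \<longleftrightarrow>
     stack_theory T \<and> \<not> inconsistent T \<and>
     (\<forall>T'. stack_theory T' \<and> T \<subset> T' \<longrightarrow> inconsistent T')"

end

(* The idea is to replace outer reduction by an inductive convergence predicate conv on processes,
   which evaluates only the head: a term has a proper outer normal form iff applying it to a
   variable converges, and, since head contexts can realize any substitution followed by an
   application, two terms are operationally equivalent iff all their substitution instances,
   applied to any stack, converge together.

   Congruence reduces to a single extensionality property: the behaviour of a process P depends on
   a stack substituted into it only through the components car_n of that stack, which is proved
   by induction on convergence of the instance of P.

   For maximality, non-convergent processes remain so under substitution, hence are all identified,
   whereas a convergent one is equivalent to some car_n n x applied to a stack; substituting for x
   a stack whose n-th component is a constant function turns it into an arbitrary process R.  An
   equation between a convergent and a non-convergent process thus makes every R equal to the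
   non-convergent one. *)

theory Submission
  imports Defs
begin

section \<open>Stack induction and the substitution calculus of the nameless syntax\<close>

lemma stk_induct [case_names SNil SVar Cdr SCons]:
  assumes "Q SNil" "\<And>x. Q (SVar x)" "\<And>\<pi>. Q \<pi> \<Longrightarrow> Q (Cdr \<pi>)" "\<And>M \<pi>. Q \<pi> \<Longrightarrow> Q (M ::: \<pi>)"
  shows "Q \<pi>"
proof -
  have "Q \<pi> \<and> True" for M :: trm and P :: prc
    by (rule stk_trm_prc.induct[of "\<lambda>\<pi>. Q \<pi> \<and> True" "\<lambda>_. True" "\<lambda>_. True", THEN conjunct1])
      (use assms in auto)
  then show ?thesis by blast
qed

lemma sub_sub:
  "sub_stk s (sub_stk t \<pi>) = sub_stk (\<lambda>x. sub_stk s (t x)) \<pi>"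
  "sub_trm s (sub_trm t M) = sub_trm (\<lambda>x. sub_stk s (t x)) M"
  "sub_prc s (sub_prc t P) = sub_prc (\<lambda>x. sub_stk s (t x)) P"
proof (induction \<pi> and M and P arbitrary: s t and s t and s t)
  case (MuB P)
  then show ?case
    by (auto split: nat.split simp: ren_sub sub_ren comp_def intro!: sub_cong(3))
qed auto

lemma sub_SVar:
  "sub_stk SVar \<pi> = \<pi>" "sub_trm SVar M = M" "sub_prc SVar P = P"
  using ren_as_sub[of id] ren_id by simp_all

lemma finite_fv: "finite (fv_stk \<pi>)" "finite (fv_trm M)" "finite (fv_prc P)"
proof (induction \<pi> and M and P)
  case (MuB P)
  have "fv_trm (MuB P) = Suc -` fv_prc P" by auto
  with MuB show ?case by (simp add: finite_vimageI)
qed auto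

lemma ren_funpow_Cdr: "ren_stk f ((Cdr ^^ n) \<pi>) = (Cdr ^^ n) (ren_stk f \<pi>)"
  by (induction n) auto

lemma sub_funpow_Cdr: "sub_stk s ((Cdr ^^ n) \<pi>) = (Cdr ^^ n) (sub_stk s \<pi>)"
  by (induction n) auto

text \<open>The contractum of \<open>MuB P \<star> \<pi>\<close>: index 0 is replaced by
  \<open>\<pi>\<close> and all other indices drop by one, as a binder disappears.\<close>

definition inst :: "prc \<Rightarrow> stk \<Rightarrow> prc" where
  "inst P \<pi> = sub_prc (case_nat \<pi> SVar) P"

lemma sub_inst:
  "sub_prc s (inst P \<pi>) = inst (sub_prc (case_nat (SVar 0) (\<lambda>x. ren_stk Suc (s x))) P) (sub_stk s \<pi>)"
  by (auto simp: inst_def sub_sub sub_ren comp_def sub_SVar split: nat.split intro!: sub_cong(3))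

lemma ren_inst:
  "ren_prc f (inst P \<pi>) = inst (ren_prc (case_nat 0 (\<lambda>x. Suc (f x))) P) (ren_stk f \<pi>)"
  by (auto simp: inst_def ren_sub sub_ren split: nat.split intro!: sub_cong(3))

lemma inst_ren_Suc [simp]: "inst (ren_prc Suc P) \<pi> = P"
  by (simp add: inst_def sub_ren comp_def sub_SVar)

lemma sub_ren_Suc [simp]:
  "sub_stk (case_nat \<pi> SVar) (ren_stk Suc \<rho>) = \<rho>"
  "sub_trm (case_nat \<pi> SVar) (ren_trm Suc M) = M"
  by (simp_all add: sub_ren comp_def sub_SVar)

text \<open>The renamed process is the body of \<open>mu x P\<close>, so \<open>inst\<close> agrees
  with the named contraction rule.\<close>

lemma inst_bind: "inst (ren_prc (\<lambda>y. if y = x then 0 else Suc y) P) \<pi> = P{\<pi>//x}"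
  by (auto simp: inst_def subst_def sub_ren intro!: sub_cong(3))

section \<open>Convergence of processes\<close>

fun cdr_val :: "stk \<Rightarrow> stk" where
  "cdr_val (M ::: \<pi>) = \<pi>"
| "cdr_val \<pi> = Cdr \<pi>"

fun car_val :: "stk \<Rightarrow> trm" where
  "car_val (M ::: \<pi>) = M"
| "car_val \<pi> = Car \<pi>"

text \<open>Weak evaluation of a stack: the \<open>Cdr\<close> redexes along its spine are
  contracted while the entries stay untouched, which is all that finding the head of a process
  requires.\<close>

primrec spine :: "stk \<Rightarrow> stk" where
  "spine SNil = SNil"
| "spine (SVar x) = SVar x"
| "spine (Cdr \<pi>) = cdr_val (spine \<pi>)"
| "spine (M ::: \<pi>) = M ::: spine \<pi>"

inductive spine_val :: "stk \<Rightarrow> bool" where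
  Var: "spine_val ((Cdr ^^ n) (SVar x))"
| Nil: "spine_val ((Cdr ^^ n) SNil)"
| Cons: "spine_val \<pi> \<Longrightarrow> spine_val (M ::: \<pi>)"

lemma cdr_val_funpow:
  "cdr_val ((Cdr ^^ n) SNil) = (Cdr ^^ Suc n) SNil"
  "cdr_val ((Cdr ^^ n) (SVar x)) = (Cdr ^^ Suc n) (SVar x)"
  by (cases n; simp)+

lemma spine_val_cdr: "spine_val \<pi> \<Longrightarrow> spine_val (cdr_val \<pi>)"
  by (induction rule: spine_val.induct) (simp_all add: cdr_val_funpow spine_val.intros del: funpow.simps)

lemma spine_val_spine: "spine_val (spine \<pi>)"
proof (induction \<pi> rule: stk_induct)
  case SNil
  show ?case using spine_val.Nil[of 0] by simp
next
  case (SVar x)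
  show ?case using spine_val.Var[of 0] by simp
qed (auto intro: spine_val.Cons spine_val_cdr)

lemma spine_cases:
  obtains (Cons) M \<pi>' where "spine \<pi> = M ::: \<pi>'"
  | (Var) n x where "spine \<pi> = (Cdr ^^ n) (SVar x)"
  | (Nil) n where "spine \<pi> = (Cdr ^^ n) SNil"
  using spine_val_spine[of \<pi>] by (cases rule: spine_val.cases) auto

lemma spine_funpow [simp]:
  "spine ((Cdr ^^ n) (SVar x)) = (Cdr ^^ n) (SVar x)"
  "spine ((Cdr ^^ n) SNil) = (Cdr ^^ n) SNil"
  by (induction n) (simp_all add: cdr_val_funpow)

text \<open>A stack put for a variable below \<open>Cdr\<close> can create new redexes, hence the
  outer \<open>spine\<close> on the right. A renaming creates none, so there \<open>spine\<close>
  simply commutes.\<close>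

lemma spine_sub: "spine (sub_stk s \<pi>) = spine (sub_stk s (spine \<pi>))"
proof (induction \<pi> rule: stk_induct)
  case (Cdr \<pi>)
  then show ?case by (cases "spine \<pi>") auto
qed auto

lemma spine_ren: "spine (ren_stk f \<pi>) = ren_stk f (spine \<pi>)"
proof (induction \<pi> rule: stk_induct)
  case (Cdr \<pi>)
  then show ?case by (cases "spine \<pi>") auto
qed auto

lemma funpow_Cdr_neq [simp]:
  "(Cdr ^^ n) (SVar x) \<noteq> (Cdr ^^ m) SNil" "(Cdr ^^ n) SNil \<noteq> (Cdr ^^ m) (SVar x)"
  "(Cdr ^^ n) (SVar x) \<noteq> M ::: \<pi>" "M ::: \<pi> \<noteq> (Cdr ^^ n) (SVar x)"
  "(Cdr ^^ n) SNil \<noteq> M ::: \<pi>" "M ::: \<pi> \<noteq> (Cdr ^^ n) SNil"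
proof -
  show "(Cdr ^^ n) (SVar x) \<noteq> (Cdr ^^ m) SNil" for n m
  proof (induction n arbitrary: m)
    case 0
    show ?case by (cases m) auto
  next
    case (Suc n)
    then show ?case by (cases m) auto
  qed
  then show "(Cdr ^^ n) SNil \<noteq> (Cdr ^^ m) (SVar x)" by metis
qed (cases n; simp)+

text \<open>Evaluation of the head alone. A head variable succeeds at once, whereas a head built on
  \<open>SNil\<close> has no rule, so improper normal forms count as divergent.\<close>

inductive conv :: "prc \<Rightarrow> bool" where
  Var: "spine \<pi> = (Cdr ^^ n) (SVar x) \<Longrightarrow> conv (Car \<pi> \<star> \<rho>)"
| Cons: "spine \<pi> = M ::: \<pi>' \<Longrightarrow> conv (M \<star> \<rho>) \<Longrightarrow> conv (Car \<pi> \<star> \<rho>)"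
| Mu: "conv (inst P \<pi>) \<Longrightarrow> conv (MuB P \<star> \<pi>)"

inductive_cases conv_CarE: "conv (Car \<pi> \<star> \<rho>)"
inductive_cases conv_MuBE: "conv (MuB P \<star> \<rho>)"

lemma conv_MuB [simp]: "conv (MuB P \<star> \<pi>) \<longleftrightarrow> conv (inst P \<pi>)"
  by (auto elim: conv_MuBE intro: conv.Mu)

lemma conv_Cons: "spine \<pi> = M ::: \<pi>' \<Longrightarrow> conv (Car \<pi> \<star> \<rho>) \<longleftrightarrow> conv (M \<star> \<rho>)"
  by (auto elim: conv_CarE intro: conv.Cons)

lemma conv_Nil: "spine \<pi> = (Cdr ^^ n) SNil \<Longrightarrow> \<not> conv (Car \<pi> \<star> \<rho>)"
  by (auto elim: conv_CarE)

lemma conv_Car_cong: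
  assumes "spine \<pi> = spine \<pi>'"
  shows "conv (Car \<pi> \<star> \<rho>) \<longleftrightarrow> conv (Car \<pi>' \<star> \<rho>)"
  by (cases \<pi> rule: spine_cases) (use assms in \<open>auto simp: conv_Cons conv_Nil intro: conv.Var\<close>)

lemma conv_ren: "conv P \<Longrightarrow> conv (ren_prc f P)"
proof (induction arbitrary: f rule: conv.induct)
  case (Var \<pi> n x \<rho>)
  then have "spine (ren_stk f \<pi>) = (Cdr ^^ n) (SVar (f x))"
    by (simp add: spine_ren ren_funpow_Cdr)
  then show ?case by (auto intro: conv.Var)
next
  case (Cons \<pi> M \<pi>' \<rho>)
  then have "spine (ren_stk f \<pi>) = ren_trm f M ::: ren_stk f \<pi>'"
    by (simp add: spine_ren)
  with Cons.IH[of f] show ?case by (auto simp: conv_Cons)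
next
  case (Mu P \<pi>)
  then show ?case by (simp add: ren_inst)
qed

lemma Car_Cut_eq_sub:
  assumes "Car \<pi> \<star> \<rho> = sub_prc s P"
  obtains \<pi>' \<rho>' where "P = Car \<pi>' \<star> \<rho>'" "\<pi> = sub_stk s \<pi>'" "\<rho> = sub_stk s \<rho>'"
proof -
  obtain M \<rho>' where "P = M \<star> \<rho>'" by (cases P)
  with assms that show thesis by (cases M) auto
qed

lemma MuB_Cut_eq_sub:
  assumes "MuB Q \<star> \<rho> = sub_prc s P"
  obtains Q' \<rho>' where "P = MuB Q' \<star> \<rho>'" "inst Q \<rho> = sub_prc s (inst Q' \<rho>')"
    "\<And>t. sub_prc t P = MuB (sub_prc (case_nat (SVar 0) (\<lambda>x. ren_stk Suc (t x))) Q') \<star> sub_stk t \<rho>'"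
proof -
  obtain M \<rho>' where "P = M \<star> \<rho>'" by (cases P)
  with assms that show thesis by (cases M) (auto simp: sub_inst)
qed

text \<open>Each evaluation step of the instance either mirrors a step of \<open>P\<close> or occurs
  after the head of \<open>P\<close> has become a variable, and in the latter case \<open>P\<close>
  already converges. Hence divergence is stable under substitution.\<close>

lemma conv_subD:
  assumes "conv (sub_prc s P)"
  shows "conv P"
proof -
  have "conv Q \<Longrightarrow> Q = sub_prc s P \<Longrightarrow> conv P" for Q
  proof (induction arbitrary: P rule: conv.induct)
    case (Var \<pi> n x \<rho>)
    from Var.prems obtain \<pi>0 \<rho>0 where P: "P = Car \<pi>0 \<star> \<rho>0" "\<pi> = sub_stk s \<pi>0"
      by (rule Car_Cut_eq_sub)
    show ?case
      by (cases \<pi>0 rule: spine_cases)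
        (use P Var.hyps spine_sub[of s \<pi>0] in \<open>auto simp: sub_funpow_Cdr intro: conv.Var\<close>)
  next
    case (Cons \<pi> M \<pi>' \<rho>)
    from Cons.prems obtain \<pi>0 \<rho>0 where P: "P = Car \<pi>0 \<star> \<rho>0" "\<pi> = sub_stk s \<pi>0" "\<rho> = sub_stk s \<rho>0"
      by (rule Car_Cut_eq_sub)
    show ?case
    proof (cases \<pi>0 rule: spine_cases)
      case Cons': (Cons L \<sigma>)
      then have "M = sub_trm s L" using P Cons.hyps spine_sub[of s \<pi>0] by simp
      with Cons.IH[of "L \<star> \<rho>0"] P Cons' show ?thesis by (simp add: conv_Cons)
    next
      case (Nil n)
      then show ?thesis using P Cons.hyps spine_sub[of s \<pi>0] by (auto simp: sub_funpow_Cdr)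
    qed (use P in \<open>auto intro: conv.Var\<close>)
  next
    case (Mu Q \<pi>)
    from Mu.prems show ?case
      by (rule MuB_Cut_eq_sub) (use Mu.IH in auto)
  qed
  then show ?thesis using assms by blast
qed

lemma conv_ren_iff [simp]: "conv (ren_prc f P) \<longleftrightarrow> conv P"
  using conv_ren conv_subD[of "SVar \<circ> f" P] by (auto simp: ren_as_sub)

text \<open>Since a convergent process can consult the stack substituted for \<open>0\<close> only through its
  components, replacing it by one with larger components preserves convergence.\<close>

lemma conv_inst_mono:
  assumes le: "\<And>n \<rho>. conv (car_n n \<pi> \<star> \<rho>) \<Longrightarrow> conv (car_n n \<pi>' \<star> \<rho>)"
    and "conv (inst P \<pi>)"
  shows "conv (inst P \<pi>')"
proof -
  define s t where "s = case_nat \<pi> SVar" and "t = case_nat \<pi>' SVar"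
  have "conv Q \<Longrightarrow> Q = sub_prc s P \<Longrightarrow> conv (sub_prc t P)" for Q
  proof (induction arbitrary: P rule: conv.induct)
    case (Var \<sigma> n x \<rho>)
    from Var.prems obtain \<sigma>0 \<rho>0 where P: "P = Car \<sigma>0 \<star> \<rho>0" "\<sigma> = sub_stk s \<sigma>0"
      by (rule Car_Cut_eq_sub)
    show ?case
    proof (cases \<sigma>0 rule: spine_cases)
      case Var': (Var m y)
      show ?thesis
      proof (cases y)
        case 0
        \<comment> \<open>The head of \<open>P\<close> is component \<open>m\<close> of the stack
          put for index 0. In \<open>\<pi>\<close> it is a head variable and converges on every
          argument, so \<open>le\<close> can be used with an argument already instantiated by
          \<open>t\<close>.\<close>
        have "spine ((Cdr ^^ m) \<pi>) = (Cdr ^^ n) (SVar x)"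
          using Var' 0 P Var.hyps spine_sub[of s \<sigma>0] by (simp add: sub_funpow_Cdr s_def)
        then have "conv (car_n m \<pi> \<star> \<rho>')" for \<rho>'
          unfolding car_n_def by (rule conv.Var)
        with le have "conv (car_n m \<pi>' \<star> sub_stk t \<rho>0)" by blast
        moreover have "spine (sub_stk t \<sigma>0) = spine ((Cdr ^^ m) \<pi>')"
          using spine_sub[of t \<sigma>0] Var' 0 by (simp add: sub_funpow_Cdr t_def)
        ultimately show ?thesis
          using P conv_Car_cong[of "sub_stk t \<sigma>0" "(Cdr ^^ m) \<pi>'"] by (simp add: car_n_def)
      next
        case (Suc z)
        then show ?thesis using Var' P spine_sub[of t \<sigma>0]
          by (auto simp: sub_funpow_Cdr t_def intro: conv.Var)
      qed
    qed (use P Var.hyps spine_sub[of s \<sigma>0] in \<open>auto simp: sub_funpow_Cdr\<close>)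
  next
    case (Cons \<sigma> M \<sigma>' \<rho>)
    from Cons.prems obtain \<sigma>0 \<rho>0 where P: "P = Car \<sigma>0 \<star> \<rho>0" "\<sigma> = sub_stk s \<sigma>0" "\<rho> = sub_stk s \<rho>0"
      by (rule Car_Cut_eq_sub)
    show ?case
    proof (cases \<sigma>0 rule: spine_cases)
      case Cons': (Cons L \<tau>)
      then have "M = sub_trm s L" using P Cons.hyps spine_sub[of s \<sigma>0] by simp
      with Cons.IH[of "L \<star> \<rho>0"] P Cons' spine_sub[of t \<sigma>0] show ?thesis by (simp add: conv_Cons)
    next
      case (Var m y)
      show ?thesis
      proof (cases y)
        case 0
        have \<sigma>: "spine ((Cdr ^^ m) \<pi>) = M ::: \<sigma>'"
          using Var 0 P Cons.hyps spine_sub[of s \<sigma>0] by (simp add: sub_funpow_Cdr s_def)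
        \<comment> \<open>\<open>ren_trm Suc M\<close> avoids index 0, so \<open>s\<close> and
          \<open>t\<close> both map it to \<open>M\<close>. The induction hypothesis for
          \<open>ren_trm Suc M \<star> \<rho>0\<close> thus exchanges the stacks in the argument
          only; \<open>le\<close> then exchanges the head.\<close>
        have "conv (M \<star> sub_stk t \<rho>0)"
          using Cons.IH[of "ren_trm Suc M \<star> \<rho>0"] P by (simp add: s_def t_def)
        with \<sigma> have "conv (car_n m \<pi>' \<star> sub_stk t \<rho>0)"
          by (intro le) (simp add: car_n_def conv_Cons)
        moreover have "spine (sub_stk t \<sigma>0) = spine ((Cdr ^^ m) \<pi>')"
          using spine_sub[of t \<sigma>0] Var 0 by (simp add: sub_funpow_Cdr t_def)
        ultimately show ?thesis
          using P conv_Car_cong[of "sub_stk t \<sigma>0" "(Cdr ^^ m) \<pi>'"] by (simp add: car_n_def)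
      next
        case (Suc z)
        then show ?thesis using Var P spine_sub[of t \<sigma>0]
          by (auto simp: sub_funpow_Cdr t_def intro: conv.Var)
      qed
    next
      case (Nil n)
      then show ?thesis using P Cons.hyps spine_sub[of s \<sigma>0] by (auto simp: sub_funpow_Cdr)
    qed
  next
    case (Mu Q \<rho>)
    from Mu.prems obtain Q' \<rho>' where "P = MuB Q' \<star> \<rho>'" and eq: "inst Q \<rho> = sub_prc s (inst Q' \<rho>')"
      by (rule MuB_Cut_eq_sub)
    with Mu.IH[OF eq] show ?case by (simp add: sub_inst)
  qed
  then show ?thesis using assms(2) by (auto simp: inst_def s_def t_def)
qed

section \<open>Observational equality\<close>

text \<open>Substitutions and one argument stack take the place of head contexts; ranging over all
  \<open>s\<close> lets the relation pass under \<open>mu\<close>.\<close>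

definition eq_trm :: "trm \<Rightarrow> trm \<Rightarrow> bool" where
  "eq_trm M N \<longleftrightarrow> (\<forall>s \<rho>. conv (sub_trm s M \<star> \<rho>) \<longleftrightarrow> conv (sub_trm s N \<star> \<rho>))"

definition eq_prc :: "prc \<Rightarrow> prc \<Rightarrow> bool" where
  "eq_prc P Q \<longleftrightarrow> (\<forall>s. conv (sub_prc s P) \<longleftrightarrow> conv (sub_prc s Q))"

text \<open>Extensional: it identifies \<open>Car \<pi> ::: Cdr \<pi>\<close> with
  \<open>\<pi>\<close>, and \<open>Cdr SNil\<close> with \<open>SNil\<close>.\<close>

definition eq_stk :: "stk \<Rightarrow> stk \<Rightarrow> bool" where
  "eq_stk \<pi> \<rho> \<longleftrightarrow> (\<forall>n. eq_trm (car_n n \<pi>) (car_n n \<rho>))"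

section \<open>Congruence of observational equality\<close>

lemma sub_car_n: "sub_trm s (car_n n \<pi>) = car_n n (sub_stk s \<pi>)"
  by (simp add: car_n_def sub_funpow_Cdr)

lemma car_n_Cdr: "car_n n (Cdr \<pi>) = car_n (Suc n) \<pi>"
  by (simp add: car_n_def funpow_swap1)

lemma conv_Car_SCons [simp]: "conv (Car (M ::: \<pi>) \<star> \<rho>) \<longleftrightarrow> conv (M \<star> \<rho>)"
  by (simp add: conv_Cons)

lemma conv_car_n_SCons:
  "conv (car_n n (M ::: \<pi>) \<star> \<rho>) \<longleftrightarrow> (case n of 0 \<Rightarrow> conv (M \<star> \<rho>) | Suc m \<Rightarrow> conv (car_n m \<pi> \<star> \<rho>))"
proof (cases n)
  case (Suc m)
  have "spine ((Cdr ^^ m) (Cdr (M ::: \<pi>))) = spine ((Cdr ^^ m) \<pi>)" for m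
    by (induction m) auto
  from conv_Car_cong[OF this] Suc show ?thesis
    by (simp add: car_n_def funpow_swap1)
qed (simp add: car_n_def)

text \<open>For each \<open>s\<close>, both instances arise from the single process
  \<open>?P\<close> by filling index 0, so \<open>conv_inst_mono\<close> applies in both
  directions.\<close>

lemma eq_prc_Cut2:
  assumes "eq_stk \<pi> \<rho>"
  shows "eq_prc (M \<star> \<pi>) (M \<star> \<rho>)"
  unfolding eq_prc_def
proof
  fix s
  let ?P = "ren_trm Suc (sub_trm s M) \<star> SVar 0"
  have inst: "inst ?P \<sigma> = sub_trm s M \<star> \<sigma>" for \<sigma>
    by (simp add: inst_def)
  have "conv (car_n n (sub_stk s \<pi>) \<star> \<sigma>) \<longleftrightarrow> conv (car_n n (sub_stk s \<rho>) \<star> \<sigma>)" for n \<sigma>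
    using assms unfolding eq_stk_def eq_trm_def sub_car_n by blast
  then have "conv (inst ?P (sub_stk s \<pi>)) \<longleftrightarrow> conv (inst ?P (sub_stk s \<rho>))"
    using conv_inst_mono by metis
  then show "conv (sub_prc s (M \<star> \<pi>)) \<longleftrightarrow> conv (sub_prc s (M \<star> \<rho>))"
    by (simp add: inst)
qed

lemma eq_prc_Cut1: "eq_trm M N \<Longrightarrow> eq_prc (M \<star> \<pi>) (N \<star> \<pi>)"
  by (simp add: eq_prc_def eq_trm_def)

lemma conv_sub_mu: "conv (sub_trm s (mu \<alpha> P) \<star> \<pi>) \<longleftrightarrow> conv (sub_prc (s(\<alpha> := \<pi>)) P)"
proof -
  have "inst (sub_prc (case_nat (SVar 0) (\<lambda>x. ren_stk Suc (s x)))
      (ren_prc (\<lambda>y. if y = \<alpha> then 0 else Suc y) P)) \<pi> = sub_prc (s(\<alpha> := \<pi>)) P"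
    by (auto simp: inst_def sub_sub sub_ren sub_SVar comp_def intro!: sub_cong(3))
  then show ?thesis by (simp add: mu_def)
qed

lemma eq_trm_mu_iff: "eq_trm (mu \<alpha> P) (mu \<alpha> Q) \<longleftrightarrow> eq_prc P Q"
  \<comment> \<open>From left to right the argument stack is taken to be \<open>s \<alpha>\<close>,
    so that the updated substitution is \<open>s\<close> again.\<close>
  unfolding eq_trm_def eq_prc_def conv_sub_mu by (metis fun_upd_triv)

lemma eq_stk_SCons: "eq_trm M N \<Longrightarrow> eq_stk \<pi> \<rho> \<Longrightarrow> eq_stk (M ::: \<pi>) (N ::: \<rho>)"
  by (auto simp: eq_stk_def eq_trm_def sub_car_n conv_car_n_SCons split: nat.split)

lemma eq_stk_Cdr: "eq_stk \<pi> \<rho> \<Longrightarrow> eq_stk (Cdr \<pi>) (Cdr \<rho>)"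
  by (simp add: eq_stk_def car_n_Cdr)

lemma eq_trm_Car: "eq_stk \<pi> \<rho> \<Longrightarrow> eq_trm (Car \<pi>) (Car \<rho>)"
  unfolding eq_stk_def by (drule spec[of _ 0]) (simp add: car_n_def)

lemma eq_refl [simp]: "eq_stk \<pi> \<pi>" "eq_trm M M" "eq_prc P P"
  by (simp_all add: eq_stk_def eq_trm_def eq_prc_def)

text \<open>Connects the componentwise comparison with the one in \<open>op_theory\<close>, where
  stacks are tested as arguments of arbitrary terms.\<close>

lemma eq_stk_alt: "eq_stk \<pi> \<rho> \<longleftrightarrow> (\<forall>M. eq_prc (M \<star> \<pi>) (M \<star> \<rho>))"
proof
  assume eq: "\<forall>M. eq_prc (M \<star> \<pi>) (M \<star> \<rho>)"
  have "finite (fv_stk \<pi> \<union> fv_stk \<rho>)"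
    by (intro finite_UnI finite_fv)
  then obtain z where z: "z \<notin> fv_stk \<pi> \<union> fv_stk \<rho>"
    using ex_new_if_finite[OF infinite_UNIV_nat] by blast
  show "eq_stk \<pi> \<rho>"
    unfolding eq_stk_def eq_trm_def sub_car_n
  proof (intro allI)
    fix n \<sigma> and s :: "nat \<Rightarrow> stk"
    \<comment> \<open>\<open>?M\<close> selects component \<open>n\<close> of its argument and
      applies it to the fresh variable \<open>z\<close>, for which \<open>?s\<close> supplies the
      arbitrary stack \<open>\<sigma>\<close>. The index is \<open>Suc z\<close> because it lies
      under the binder.\<close>
    let ?M = "MuB (car_n n (SVar 0) \<star> SVar (Suc z))" and ?s = "s(z := \<sigma>)"
    have *: "conv (sub_prc ?s (?M \<star> \<tau>)) \<longleftrightarrow> conv (car_n n (sub_stk s \<tau>) \<star> \<sigma>)" if "z \<notin> fv_stk \<tau>" for \<tau>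
    proof -
      have "sub_stk ?s \<tau> = sub_stk s \<tau>" using that by (intro sub_cong(1)) auto
      then show ?thesis by (simp add: sub_car_n inst_def)
    qed
    show "conv (car_n n (sub_stk s \<pi>) \<star> \<sigma>) \<longleftrightarrow> conv (car_n n (sub_stk s \<rho>) \<star> \<sigma>)"
      using eq z *[of \<pi>] *[of \<rho>] unfolding eq_prc_def by blast
  qed
qed (auto intro: eq_prc_Cut2)

section \<open>Observational equality as a stack-theory\<close>

inductive_set obs_theory :: "expr rel" where
  Stk: "eq_stk \<pi> \<rho> \<Longrightarrow> (Stk \<pi>, Stk \<rho>) \<in> obs_theory"
| Trm: "eq_trm M N \<Longrightarrow> (Trm M, Trm N) \<in> obs_theory"
| Prc: "eq_prc P Q \<Longrightarrow> (Prc P, Prc Q) \<in> obs_theory"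

lemma obs_theory_iff [simp]:
  "(Stk \<pi>, Stk \<rho>) \<in> obs_theory \<longleftrightarrow> eq_stk \<pi> \<rho>"
  "(Trm M, Trm N) \<in> obs_theory \<longleftrightarrow> eq_trm M N"
  "(Prc P, Prc Q) \<in> obs_theory \<longleftrightarrow> eq_prc P Q"
  by (auto intro: obs_theory.intros elim: obs_theory.cases)

lemma equiv_obs_theory: "equiv UNIV obs_theory"
proof (rule equivI)
  show "refl obs_theory"
  proof (rule refl_onI)
    fix E show "(E, E) \<in> obs_theory" by (cases E) auto
  qed
  show "sym obs_theory"
    by (rule symI) (erule obs_theory.cases; simp add: eq_stk_def eq_trm_def eq_prc_def)
  show "trans obs_theory"
    by (rule transI) (erule obs_theory.cases; erule obs_theory.cases; simp add: eq_stk_def eq_trm_def eq_prc_def)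
qed auto

lemma compat_obs_theory: "compat obs_theory \<subseteq> obs_theory"
proof (rule subrelI)
  fix E F assume "(E, F) \<in> compat obs_theory"
  then show "(E, F) \<in> obs_theory"
    by (induction rule: compat.induct)
      (auto simp: eq_trm_mu_iff intro: eq_stk_Cdr eq_stk_SCons eq_trm_Car eq_prc_Cut1 eq_prc_Cut2)
qed

lemma compat_mono: "R \<subseteq> S \<Longrightarrow> compat R \<subseteq> compat S"
proof (rule subrelI)
  fix E F assume "R \<subseteq> S" "(E, F) \<in> compat R"
  from this(2,1) show "(E, F) \<in> compat S"
    by (induction rule: compat.induct) (auto intro: compat.intros)
qed

lemma rules_obs_theory: "mu_rule \<union> carcdr_rules \<subseteq> obs_theory"
proof -
  have "eq_prc (mu \<alpha> P \<star> \<pi>) (subst P \<pi> \<alpha>)" for \<alpha> P \<pi>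
    unfolding eq_prc_def subst_def sub_sub
    by (auto simp: conv_sub_mu fun_upd_def intro!: arg_cong[of _ _ conv] sub_cong(3))
  moreover have "eq_trm (Car (M ::: \<pi>)) M" for M \<pi>
    by (simp add: eq_trm_def)
  moreover have "eq_stk (Cdr (M ::: \<pi>)) \<pi>" for M \<pi>
    by (simp add: eq_stk_def eq_trm_def car_n_Cdr sub_car_n conv_car_n_SCons)
  ultimately show ?thesis
    by (auto simp: mu_rule_def carcdr_rules_def)
qed

lemma eq_s_obs_theory: "eq_s \<subseteq> obs_theory"
proof -
  let ?R = "compat (mu_rule \<union> carcdr_rules)"
  have "?R \<subseteq> obs_theory"
    using compat_mono[OF rules_obs_theory] compat_obs_theory by blast
  then have "?R \<union> ?R\<inverse> \<subseteq> obs_theory"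
    using equiv_obs_theory by (auto simp: equiv_def dest: symD)
  then have "(?R \<union> ?R\<inverse>)\<^sup>* \<subseteq> obs_theory\<^sup>*"
    by (rule rtrancl_mono)
  moreover have "obs_theory\<^sup>* \<subseteq> obs_theory"
    using equiv_obs_theory by (auto simp: equiv_def refl_on_def trancl_id simp flip: reflcl_trancl)
  ultimately show ?thesis by (simp add: eq_s_def Let_def)
qed

lemma stack_theory_obs_theory: "stack_theory obs_theory"
  unfolding stack_theory_def well_sorted_def
  using equiv_obs_theory eq_s_obs_theory compat_obs_theory by (auto elim: obs_theory.cases)

section \<open>Canonical forms and outer reduction\<close>

text \<open>Computes canonical forms in one bottom-up pass: contracting \<open>Car\<close> or
  \<open>Cdr\<close> on a canonical stack exposes a component that is already canonical.\<close>

primrec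
  nf_stk :: "stk \<Rightarrow> stk" and nf_trm :: "trm \<Rightarrow> trm" and nf_prc :: "prc \<Rightarrow> prc"
where
  "nf_stk SNil = SNil"
| "nf_stk (SVar x) = SVar x"
| "nf_stk (Cdr \<pi>) = cdr_val (nf_stk \<pi>)"
| "nf_stk (M ::: \<pi>) = nf_trm M ::: nf_stk \<pi>"
| "nf_trm (Car \<pi>) = car_val (nf_stk \<pi>)"
| "nf_trm (MuB P) = MuB (nf_prc P)"
| "nf_prc (M \<star> \<pi>) = nf_trm M \<star> nf_stk \<pi>"

fun nf :: "expr \<Rightarrow> expr" where
  "nf (Stk \<pi>) = Stk (nf_stk \<pi>)"
| "nf (Trm M) = Trm (nf_trm M)"
| "nf (Prc P) = Prc (nf_prc P)"

lemma nf_ren: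
  "nf_stk (ren_stk f \<pi>) = ren_stk f (nf_stk \<pi>)"
  "nf_trm (ren_trm f M) = ren_trm f (nf_trm M)"
  "nf_prc (ren_prc f P) = ren_prc f (nf_prc P)"
proof (induction \<pi> and M and P arbitrary: f and f and f)
  case (Cdr \<pi>)
  then show ?case by (cases "nf_stk \<pi>") auto
next
  case (Car \<pi>)
  then show ?case by (cases "nf_stk \<pi>") auto
qed auto

lemma nf_sub_nf:
  "nf_stk (sub_stk s (nf_stk \<pi>)) = nf_stk (sub_stk s \<pi>)"
  "nf_trm (sub_trm s (nf_trm M)) = nf_trm (sub_trm s M)"
  "nf_prc (sub_prc s (nf_prc P)) = nf_prc (sub_prc s P)"
proof (induction \<pi> and M and P arbitrary: s and s and s)
  case (Cdr \<pi>)
  from Cdr[of s, symmetric] show ?case by (cases "nf_stk \<pi>") auto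
next
  case (Car \<pi>)
  from Car[of s, symmetric] show ?case by (cases "nf_stk \<pi>") auto
qed auto

lemma nf_idem:
  "nf_stk (nf_stk \<pi>) = nf_stk \<pi>" "nf_trm (nf_trm M) = nf_trm M" "nf_prc (nf_prc P) = nf_prc P"
  using nf_sub_nf[of SVar] by (simp_all add: sub_SVar)

lemma nf_sub_cong:
  "(\<And>x. nf_stk (s x) = nf_stk (t x)) \<Longrightarrow> nf_stk (sub_stk s \<pi>) = nf_stk (sub_stk t \<pi>)"
  "(\<And>x. nf_stk (s x) = nf_stk (t x)) \<Longrightarrow> nf_trm (sub_trm s M) = nf_trm (sub_trm t M)"
  "(\<And>x. nf_stk (s x) = nf_stk (t x)) \<Longrightarrow> nf_prc (sub_prc s P) = nf_prc (sub_prc t P)"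
proof (induction \<pi> and M and P arbitrary: s t and s t and s t)
  case (SCons M \<pi>)
  show ?case using SCons.IH[of s t] SCons.prems by simp
next
  case (Cdr \<pi>)
  show ?case using Cdr.IH[of s t] Cdr.prems by simp
next
  case (Car \<pi>)
  show ?case using Car.IH[of s t] Car.prems by simp
next
  case (Cut M \<pi>)
  show ?case using Cut.IH[of s t] Cut.prems by simp
next
  case (MuB P)
  have "nf_prc (sub_prc (case_nat (SVar 0) (\<lambda>x. ren_stk Suc (s x))) P)
      = nf_prc (sub_prc (case_nat (SVar 0) (\<lambda>x. ren_stk Suc (t x))) P)"
    using MuB.prems by (intro MuB.IH) (simp add: nf_ren split: nat.split)
  then show ?case by simp
qed simp_all

text \<open>Outer reduction contracts canonical forms while \<open>conv\<close> contracts processes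
  as they are; the two contracta agree up to canonical form.\<close>

lemma nf_inst: "nf_prc (inst (nf_prc P) (nf_stk \<pi>)) = nf_prc (inst P \<pi>)"
  unfolding inst_def nf_sub_nf(3)
  by (rule nf_sub_cong) (auto simp: nf_idem split: nat.split)

text \<open>The explicit body allows two abstractions to be opened with the same variable and the
  same renaming.\<close>

lemma MuB_eq_mu_ren:
  assumes "x \<notin> fv_trm (MuB P)"
  shows "MuB P = mu x (ren_prc (case_nat x (\<lambda>y. y)) P)"
proof -
  have "ren_prc ((\<lambda>y. if y = x then 0 else Suc y) \<circ> case_nat x (\<lambda>y. y)) P = ren_prc id P"
    using assms by (intro ren_cong) (auto split: nat.splits)
  then show ?thesis by (simp add: mu_def ren_ren ren_id)
qed

fun ren_expr :: "(nat \<Rightarrow> nat) \<Rightarrow> expr \<Rightarrow> expr" where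
  "ren_expr f (Stk \<pi>) = Stk (ren_stk f \<pi>)"
| "ren_expr f (Trm M) = Trm (ren_trm f M)"
| "ren_expr f (Prc P) = Prc (ren_prc f P)"

abbreviation step :: "expr rel" where
  "step \<equiv> compat carcdr_rules"

text \<open>\<open>compat\<close> passes only under the named \<open>mu\<close>. Opening both sides
  with a common fresh variable renames the bodies, so the premise ranges over renamings;
  \<open>step_ren\<close> relies on this form in its own \<open>mu\<close> case.\<close>

lemma step_MuB_if_ren:
  assumes "\<And>f. (Prc (ren_prc f P), Prc (ren_prc f Q)) \<in> step"
  shows "(Trm (MuB P), Trm (MuB Q)) \<in> step"
proof -
  have "finite (fv_trm (MuB P) \<union> fv_trm (MuB Q))"
    by (intro finite_UnI finite_fv)
  then obtain x where "x \<notin> fv_trm (MuB P) \<union> fv_trm (MuB Q)"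
    using ex_new_if_finite[OF infinite_UNIV_nat] by blast
  then have eq: "MuB P = mu x (ren_prc (case_nat x (\<lambda>y. y)) P)" "MuB Q = mu x (ren_prc (case_nat x (\<lambda>y. y)) Q)"
    by (intro MuB_eq_mu_ren; blast)+
  show ?thesis
    unfolding eq by (intro compat.mu assms)
qed

lemma step_ren: "(E, F) \<in> step \<Longrightarrow> (ren_expr f E, ren_expr f F) \<in> step"
proof (induction arbitrary: f rule: compat.induct)
  case (base E F)
  then have "(ren_expr f E, ren_expr f F) \<in> carcdr_rules"
    by (auto simp: carcdr_rules_def)
  then show ?case by (rule compat.base)
next
  case (mu P Q \<alpha>)
  show ?case
    unfolding mu_def ren_expr.simps ren_trm.simps ren_ren
    using mu.IH by (intro step_MuB_if_ren) (simp add: ren_ren)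
qed (auto intro: compat.intros)

lemma step_MuB:
  assumes "(Prc P, Prc Q) \<in> step"
  shows "(Trm (MuB P), Trm (MuB Q)) \<in> step"
  using step_ren[OF assms] by (intro step_MuB_if_ren) simp

lemma nf_step: "(E, F) \<in> step \<Longrightarrow> nf E = nf F"
  by (induction rule: compat.induct) (auto simp: carcdr_rules_def mu_def nf_ren)

fun esize :: "expr \<Rightarrow> nat" where
  "esize (Stk \<pi>) = size \<pi>"
| "esize (Trm M) = size M"
| "esize (Prc P) = size P"

lemma size_ren [simp]:
  "size (ren_stk f \<pi>) = size \<pi>" "size (ren_trm f M) = size M" "size (ren_prc f P) = size P"
  by (induction \<pi> and M and P arbitrary: f and f and f) auto

lemma esize_step: "(E, F) \<in> step \<Longrightarrow> esize F < esize E"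
  by (induction rule: compat.induct) (auto simp: carcdr_rules_def mu_def)

lemma step_sort:
  "(Stk \<pi>, F) \<in> step \<Longrightarrow> F \<in> range Stk"
  "(Trm M, F) \<in> step \<Longrightarrow> F \<in> range Trm"
  "(Prc P, F) \<in> step \<Longrightarrow> F \<in> range Prc"
  by (erule compat.cases; auto simp: carcdr_rules_def)+

lemma Domain_step:
  "Stk \<pi> \<in> Domain step \<Longrightarrow> Stk (Cdr \<pi>) \<in> Domain step"
  "Trm M \<in> Domain step \<Longrightarrow> Stk (M ::: \<pi>) \<in> Domain step"
  "Stk \<pi> \<in> Domain step \<Longrightarrow> Stk (M ::: \<pi>) \<in> Domain step"
  "Stk \<pi> \<in> Domain step \<Longrightarrow> Trm (Car \<pi>) \<in> Domain step"
  "Prc P \<in> Domain step \<Longrightarrow> Trm (MuB P) \<in> Domain step"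
  "Trm M \<in> Domain step \<Longrightarrow> Prc (M \<star> \<pi>) \<in> Domain step"
  "Stk \<pi> \<in> Domain step \<Longrightarrow> Prc (M \<star> \<pi>) \<in> Domain step"
  "Stk (Cdr (M ::: \<pi>)) \<in> Domain step"
  "Trm (Car (M ::: \<pi>)) \<in> Domain step"
  by (erule DomainE, frule step_sort, erule imageE, hypsubst, rule DomainI, erule compat.intros step_MuB)+
    (rule DomainI, rule compat.base, force simp: carcdr_rules_def)+

lemma nf_eq_if_normal:
  "Stk \<pi> \<notin> Domain step \<Longrightarrow> nf_stk \<pi> = \<pi>"
  "Trm M \<notin> Domain step \<Longrightarrow> nf_trm M = M"
  "Prc P \<notin> Domain step \<Longrightarrow> nf_prc P = P"
proof (induction \<pi> and M and P)
  case (Cdr \<pi>)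
  then have "nf_stk \<pi> = \<pi>" using Domain_step(1) by blast
  with Cdr.prems Domain_step(8) show ?case by (cases \<pi>) auto
next
  case (Car \<pi>)
  then have "nf_stk \<pi> = \<pi>" using Domain_step(4) by blast
  with Car.prems Domain_step(9) show ?case by (cases \<pi>) auto
qed (simp_all, (blast intro: Domain_step)+)

text \<open>Steps shrink an expression and preserve \<open>nf\<close>, so every expression steps
  down to a normal one, which is its own \<open>nf\<close>.\<close>

lemma steps_nf: "(E, nf E) \<in> step\<^sup>*"
proof (induction "esize E" arbitrary: E rule: less_induct)
  case less
  show ?case
  proof (cases "E \<in> Domain step")
    case True
    then obtain F where "(E, F) \<in> step" by blast
    with less[of F] esize_step nf_step show ?thesis by (metis converse_rtrancl_into_rtrancl)
  next
    case False
    then have "nf E = E" by (cases E) (auto simp: nf_eq_if_normal)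
    then show ?thesis by simp
  qed
qed

lemma esize_nf_le: "esize (nf E) \<le> esize E"
  using steps_nf[of E] by (induction rule: rtrancl_induct) (auto dest: esize_step)

lemma nf_nf: "nf (nf E) = nf E"
  by (cases E) (auto simp: nf_idem)

text \<open>A contractum \<open>G\<close> of \<open>nf E\<close> would be strictly smaller than
  \<open>nf E\<close>; but \<open>nf E\<close> equals \<open>nf G\<close>, which is at most as large
  as \<open>G\<close>.\<close>

lemma nf_normal: "nf E \<notin> Domain step"
proof
  assume "nf E \<in> Domain step"
  then obtain G where G: "(nf E, G) \<in> step" by blast
  then have "nf G = nf E" using nf_step[OF G] nf_nf by simp
  then show False using esize_step[OF G] esize_nf_le[of G] by simp
qed

lemma canonical_form_iff: "canonical_form E F \<longleftrightarrow> F = nf E"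
proof
  assume "canonical_form E F"
  then have steps: "(E, F) \<in> step\<^sup>*" and F: "F \<notin> Domain step" by (auto simp: canonical_form_def)
  from steps have "nf E = nf F" by (induction rule: rtrancl_induct) (auto dest: nf_step)
  moreover have "nf F = F" using F by (cases F) (auto simp: nf_eq_if_normal)
  ultimately show "F = nf E" by simp
qed (use nf_normal steps_nf in \<open>auto simp: canonical_form_def\<close>)

lemma canonical_form_Trm [simp]: "canonical_form (Trm M) (Trm N) \<longleftrightarrow> nf_trm M = N"
  by (auto simp: canonical_form_iff)

section \<open>Outer reduction and proper outer normal forms in nameless terms\<close>

lemma mu_mu_Cut:
  obtains P' \<pi>' where "mu \<alpha> (mu \<beta> P \<star> \<pi>) = MuB (MuB P' \<star> \<pi>')" "mu \<alpha> (subst P \<pi> \<beta>) = MuB (inst P' \<pi>')"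
proof -
  have "subst P \<pi> \<beta> = inst (ren_prc (\<lambda>y. if y = \<beta> then 0 else Suc y) P) \<pi>"
    by (simp add: inst_bind)
  then have "mu \<alpha> (subst P \<pi> \<beta>) = MuB (inst (ren_prc (case_nat 0 (\<lambda>x. Suc (if x = \<alpha> then 0 else Suc x)))
      (ren_prc (\<lambda>y. if y = \<beta> then 0 else Suc y) P)) (ren_stk (\<lambda>y. if y = \<alpha> then 0 else Suc y) \<pi>))"
    by (simp add: mu_def ren_inst)
  with that show thesis by (simp add: mu_def)
qed

lemma ex_mu:
  obtains x where "MuB P = mu x (ren_prc (case_nat x (\<lambda>y. y)) P)"
proof -
  obtain x where "x \<notin> fv_trm (MuB P)"
    using ex_new_if_finite[OF infinite_UNIV_nat finite_fv(2)] by blast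
  with that show thesis using MuB_eq_mu_ren by blast
qed

lemma outer_iff: "M \<rightarrow>\<^sub>o N \<longleftrightarrow> (\<exists>P \<pi>. nf_trm M = MuB (MuB P \<star> \<pi>) \<and> N = MuB (inst P \<pi>))"
proof
  assume "M \<rightarrow>\<^sub>o N"
  then show "\<exists>P \<pi>. nf_trm M = MuB (MuB P \<star> \<pi>) \<and> N = MuB (inst P \<pi>)"
  proof cases
    case (1 \<alpha> \<beta> P \<pi>)
    obtain P' \<pi>' where "mu \<alpha> (mu \<beta> P \<star> \<pi>) = MuB (MuB P' \<star> \<pi>')" "mu \<alpha> (subst P \<pi> \<beta>) = MuB (inst P' \<pi>')"
      by (rule mu_mu_Cut)
    with 1 show ?thesis by auto
  qed
next
  assume "\<exists>P \<pi>. nf_trm M = MuB (MuB P \<star> \<pi>) \<and> N = MuB (inst P \<pi>)"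
  then obtain P \<pi> where M: "nf_trm M = MuB (MuB P \<star> \<pi>)" and N: "N = MuB (inst P \<pi>)" by blast
  \<comment> \<open>Names are chosen for both binders, giving the canonical form the shape that the
    rule of \<open>outer\<close> expects.\<close>
  obtain \<alpha> where "MuB (MuB P \<star> \<pi>) = mu \<alpha> (ren_prc (case_nat \<alpha> (\<lambda>y. y)) (MuB P \<star> \<pi>))"
    by (rule ex_mu)
  then obtain Q \<rho> where \<alpha>: "MuB (MuB P \<star> \<pi>) = mu \<alpha> (MuB Q \<star> \<rho>)" by simp
  obtain \<beta> R where "MuB Q = mu \<beta> R"
    by (rule ex_mu)
  with \<alpha> M have red: "nf_trm M = mu \<alpha> (mu \<beta> R \<star> \<rho>)" by simp
  obtain P' \<pi>' where "mu \<alpha> (mu \<beta> R \<star> \<rho>) = MuB (MuB P' \<star> \<pi>')" "mu \<alpha> (subst R \<rho> \<beta>) = MuB (inst P' \<pi>')"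
    by (rule mu_mu_Cut)
  with red M N have "N = mu \<alpha> (subst R \<rho> \<beta>)" by simp
  with red show "M \<rightarrow>\<^sub>o N" using outer.intros canonical_form_Trm by simp
qed

definition is_tail :: "stk \<Rightarrow> bool" where
  "is_tail \<pi> \<longleftrightarrow> (\<exists>Ns k \<tau>. (\<tau> = SNil \<or> (\<exists>\<gamma>. \<tau> = SVar \<gamma>)) \<and> \<pi> = foldr (:::) Ns ((Cdr ^^ k) \<tau>))"

text \<open>Derives the shape of the argument stack demanded by \<open>proper_onf\<close> from
  canonicity.\<close>

lemma is_tail_nf: "is_tail (nf_stk \<pi>)"
proof -
  have tail: "is_tail ((Cdr ^^ k) \<tau>)" if "\<tau> = SNil \<or> (\<exists>\<gamma>. \<tau> = SVar \<gamma>)" for k \<tau>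
    unfolding is_tail_def using that by (intro exI[of _ "[]"] exI[of _ k] exI[of _ \<tau>]) auto
  show ?thesis
  proof (induction \<pi> rule: stk_induct)
    case (Cdr \<pi>)
    then obtain Ns k \<tau> where \<tau>: "\<tau> = SNil \<or> (\<exists>\<gamma>. \<tau> = SVar \<gamma>)"
      and \<pi>: "nf_stk \<pi> = foldr (:::) Ns ((Cdr ^^ k) \<tau>)" unfolding is_tail_def by blast
    show ?case
    proof (cases Ns)
      case Nil
      with \<pi> \<tau> have "nf_stk (Cdr \<pi>) = (Cdr ^^ Suc k) \<tau>" by (auto simp: cdr_val_funpow)
      with tail[OF \<tau>] show ?thesis by metis
    next
      case (Cons N Ns')
      with \<pi> \<tau> show ?thesis unfolding is_tail_def by auto
    qed
  next
    case (SCons M \<pi>)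
    then obtain Ns k \<tau> where "\<tau> = SNil \<or> (\<exists>\<gamma>. \<tau> = SVar \<gamma>)"
      and "nf_stk \<pi> = foldr (:::) Ns ((Cdr ^^ k) \<tau>)" unfolding is_tail_def by blast
    then show ?case
      unfolding is_tail_def by (intro exI[of _ "nf_trm M # Ns"] exI[of _ k] exI[of _ \<tau>]) auto
  next
    case SNil
    then show ?case using tail[of SNil 0] by simp
  next
    case (SVar x)
    then show ?case using tail[of "SVar x" 0] by simp
  qed
qed

lemma ren_car_n: "ren_trm f (car_n n \<pi>) = car_n n (ren_stk f \<pi>)"
  by (simp add: car_n_def ren_funpow_Cdr)

lemma proper_onf_iff:
  "proper_onf M \<longleftrightarrow> (\<exists>n x. nf_trm M = car_n n (SVar x) \<or> (\<exists>\<pi>. nf_trm M = MuB (car_n n (SVar x) \<star> \<pi>)))"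
  (is "_ \<longleftrightarrow> ?R")
proof
  assume "proper_onf M"
  then show ?R
    unfolding proper_onf_def by (fastforce simp: mu_def ren_car_n)
next
  assume ?R
  then obtain n x where "nf_trm M = car_n n (SVar x) \<or> (\<exists>\<pi>. nf_trm M = MuB (car_n n (SVar x) \<star> \<pi>))"
    by blast
  then show "proper_onf M"
  proof
    assume "nf_trm M = car_n n (SVar x)"
    then show ?thesis unfolding proper_onf_def onf_def outer_iff by (auto simp: car_n_def)
  next
    assume "\<exists>\<pi>. nf_trm M = MuB (car_n n (SVar x) \<star> \<pi>)"
    then obtain \<pi> where \<pi>: "nf_trm M = MuB (car_n n (SVar x) \<star> \<pi>)" by blast
    then have "nf_stk \<pi> = \<pi>"
      using nf_idem(2)[of M] by simp
    obtain \<alpha> where \<alpha>: "nf_trm M = mu \<alpha> (ren_prc (case_nat \<alpha> (\<lambda>y. y)) (car_n n (SVar x) \<star> \<pi>))"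
      unfolding \<pi> by (rule ex_mu)
    have "is_tail (ren_stk (case_nat \<alpha> (\<lambda>y. y)) \<pi>)"
      using is_tail_nf \<open>nf_stk \<pi> = \<pi>\<close> nf_ren(1) by metis
    then obtain Ns k \<tau> where \<tau>: "\<tau> = SNil \<or> (\<exists>\<gamma>. \<tau> = SVar \<gamma>)"
      "ren_stk (case_nat \<alpha> (\<lambda>y. y)) \<pi> = foldr (:::) Ns ((Cdr ^^ k) \<tau>)" unfolding is_tail_def by blast
    with \<alpha> have "nf_trm M = mu \<alpha> (car_n n (SVar (case_nat \<alpha> (\<lambda>y. y) x)) \<star> foldr (:::) Ns ((Cdr ^^ k) \<tau>))"
      by (simp add: ren_car_n)
    moreover have "onf M"
      unfolding onf_def outer_iff \<pi> by (simp add: car_n_def)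
    ultimately show ?thesis
      unfolding proper_onf_def canonical_form_Trm using \<tau>(1) by blast
  qed
qed

section \<open>Proper outer normal forms as convergence\<close>

lemma has_proper_onf_nf_cong:
  assumes "nf_trm M = nf_trm N" and "has_proper_onf M"
  shows "has_proper_onf N"
proof -
  from assms(2) obtain K where K: "outer\<^sup>*\<^sup>* M K" "proper_onf K" by (auto simp: has_proper_onf_def)
  from K(1) show ?thesis
  proof (cases rule: converse_rtranclpE)
    case base
    with K have "proper_onf N" using assms(1) by (simp add: proper_onf_iff)
    then show ?thesis by (auto simp: has_proper_onf_def)
  next
    case (step L)
    then have "N \<rightarrow>\<^sub>o L" using assms(1) by (simp add: outer_iff)
    with step K show ?thesis unfolding has_proper_onf_def by (meson converse_rtranclp_into_rtranclp)
  qed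
qed

lemma has_proper_onf_outer: "M \<rightarrow>\<^sub>o N \<Longrightarrow> has_proper_onf N \<Longrightarrow> has_proper_onf M"
  unfolding has_proper_onf_def by (meson converse_rtranclp_into_rtranclp)

lemma nf_spine: "nf_stk (spine \<pi>) = nf_stk \<pi>"
proof (induction \<pi> rule: stk_induct)
  case (Cdr \<pi>)
  from Cdr[symmetric] show ?case by (cases "spine \<pi>") auto
qed auto

lemma nf_stk_funpow: "nf_stk ((Cdr ^^ n) (SVar x)) = (Cdr ^^ n) (SVar x)"
  by (induction n) (simp_all add: cdr_val_funpow)

lemma nf_car_n_SVar: "spine \<pi> = (Cdr ^^ n) (SVar x) \<Longrightarrow> nf_trm (Car \<pi>) = car_n n (SVar x)"
proof -
  assume "spine \<pi> = (Cdr ^^ n) (SVar x)"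
  then have "nf_stk \<pi> = (Cdr ^^ n) (SVar x)" by (metis nf_spine nf_stk_funpow)
  then show ?thesis by (cases n) (auto simp: car_n_def)
qed

lemma nf_Car_Cons: "spine \<pi> = M ::: \<pi>' \<Longrightarrow> nf_trm (Car \<pi>) = nf_trm M"
  using nf_spine[of \<pi>, symmetric] by simp

lemma has_proper_onf_if_conv: "conv P \<Longrightarrow> has_proper_onf (MuB P)"
proof (induction rule: conv.induct)
  case (Var \<pi> n x \<rho>)
  then have "proper_onf (MuB (Car \<pi> \<star> \<rho>))"
    unfolding proper_onf_iff using nf_car_n_SVar by auto
  then show ?case by (auto simp: has_proper_onf_def)
next
  case (Cons \<pi> M \<pi>' \<rho>)
  then have "nf_trm (MuB (M \<star> \<rho>)) = nf_trm (MuB (Car \<pi> \<star> \<rho>))"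
    using nf_Car_Cons[of \<pi> M \<pi>'] by simp
  with Cons show ?case using has_proper_onf_nf_cong by blast
next
  case (Mu P \<pi>)
  have "MuB (MuB P \<star> \<pi>) \<rightarrow>\<^sub>o MuB (inst (nf_prc P) (nf_stk \<pi>))"
    by (simp add: outer_iff)
  moreover have "has_proper_onf (MuB (inst (nf_prc P) (nf_stk \<pi>)))"
    by (rule has_proper_onf_nf_cong[OF _ Mu.IH]) (simp add: nf_inst)
  ultimately show ?case by (rule has_proper_onf_outer)
qed

lemma eq_trm_nf: "eq_trm M (nf_trm M)"
proof -
  have "step \<subseteq> obs_theory"
    using compat_mono[of carcdr_rules obs_theory] rules_obs_theory compat_obs_theory by blast
  have "(Trm M, nf (Trm M)) \<in> step\<^sup>*" by (rule steps_nf)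
  then have "(Trm M, nf (Trm M)) \<in> obs_theory"
  proof (induction rule: rtrancl_induct)
    case base
    then show ?case by simp
  next
    case (step E F)
    with \<open>step \<subseteq> obs_theory\<close> equiv_obs_theory show ?case by (meson equivE transD subsetD)
  qed
  then show ?thesis by simp
qed

lemma eq_trmD: "eq_trm M N \<Longrightarrow> conv (M \<star> \<pi>) \<longleftrightarrow> conv (N \<star> \<pi>)"
  unfolding eq_trm_def by (metis sub_SVar(2))

lemma conv_inst_SVar: "conv (inst P (SVar x)) \<longleftrightarrow> conv P"
proof -
  have "inst P (SVar x) = ren_prc (case_nat x (\<lambda>y. y)) P"
    by (auto simp: inst_def ren_as_sub split: nat.split intro!: sub_cong(3))
  then show ?thesis by simp
qed

text \<open>Any variable serves as the argument: putting it for the bound variable of an abstraction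
  is a renaming, which neither creates nor destroys convergence. One direction follows the outer
  steps backwards, the other inducts on convergence.\<close>

lemma has_proper_onf_iff: "has_proper_onf M \<longleftrightarrow> conv (M \<star> SVar x)"
proof
  assume "has_proper_onf M"
  then obtain N where "outer\<^sup>*\<^sup>* M N" "proper_onf N" by (auto simp: has_proper_onf_def)
  then show "conv (M \<star> SVar x)"
  proof (induction rule: converse_rtranclp_induct)
    case base
    then obtain n y where "nf_trm N = car_n n (SVar y) \<or> (\<exists>\<pi>. nf_trm N = MuB (car_n n (SVar y) \<star> \<pi>))"
      unfolding proper_onf_iff by blast
    moreover have "conv (car_n n (SVar y) \<star> \<rho>)" for \<rho>
      unfolding car_n_def by (rule conv.Var[of _ n y]) simp
    ultimately have "conv (nf_trm N \<star> SVar x)"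
      by (auto simp: conv_inst_SVar)
    then show ?case using eq_trmD[OF eq_trm_nf] by blast
  next
    case (step M N)
    then obtain P \<pi> where "nf_trm M = MuB (MuB P \<star> \<pi>)" "N = MuB (inst P \<pi>)"
      unfolding outer_iff by blast
    with step have "conv (nf_trm M \<star> SVar x)" by (simp add: conv_inst_SVar)
    then show ?case using eq_trmD[OF eq_trm_nf] by blast
  qed
next
  have "conv P \<Longrightarrow> P = M \<star> SVar x \<Longrightarrow> has_proper_onf M" for P
  proof (induction arbitrary: M rule: conv.induct)
    case (Var \<pi> n y \<rho>)
    then have "nf_trm M = car_n n (SVar y)" using nf_car_n_SVar[OF Var.hyps] by auto
    then have "proper_onf M" unfolding proper_onf_iff by blast
    then show ?case by (auto simp: has_proper_onf_def)
  next
    case (Cons \<pi> N \<pi>' \<rho>)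
    then have "has_proper_onf N" "nf_trm N = nf_trm M" using nf_Car_Cons[of \<pi> N \<pi>'] by auto
    then show ?case using has_proper_onf_nf_cong by blast
  next
    case (Mu P \<pi>)
    then show ?case by (auto simp: conv_inst_SVar intro: has_proper_onf_if_conv)
  qed
  then show "conv (M \<star> SVar x) \<Longrightarrow> has_proper_onf M" by blast
qed

section \<open>Operational equivalence is observational equality\<close>

text \<open>Stated for any compatible \<open>T\<close> because it serves \<open>obs_theory\<close>
  as well as its extensions.\<close>

lemma compat_fill:
  assumes "compat T \<subseteq> T" and "(Trm M, Trm N) \<in> T"
  shows "(Trm (fill C M), Trm (fill C N)) \<in> T"
proof (induction C)
  case (HMu \<alpha> C \<pi>)
  then have "(Trm (mu \<alpha> (fill C M \<star> \<pi>)), Trm (mu \<alpha> (fill C N \<star> \<pi>))) \<in> compat T"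
    by (intro compat.mu compat.Cut1 compat.base)
  with assms(1) show ?case by auto
qed (simp add: assms)

text \<open>For distinct variables \<open>x\<^sub>1, \<dots>, x\<^sub>n\<close> not occurring in the stacks \<open>t x\<^sub>i\<close>, this
  head context substitutes \<open>t x\<^sub>i\<close> for each \<open>x\<^sub>i\<close> in its hole and then applies the result to
  \<open>\<pi>\<close>; the last argument is the variable bound outermost.\<close>

primrec closing_ctx :: "nat list \<Rightarrow> (nat \<Rightarrow> stk) \<Rightarrow> stk \<Rightarrow> nat \<Rightarrow> head_ctx" where
  "closing_ctx [] t \<pi> y = HMu y Hole \<pi>"
| "closing_ctx (x # L) t \<pi> y = HMu y (closing_ctx L t \<pi> x) (t x)"

text \<open>The substitution accumulated on the way to the hole. The bindings are sequential: each
  \<open>t x\<close> is read under those made before it.\<close>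

primrec closing_sub :: "nat list \<Rightarrow> (nat \<Rightarrow> stk) \<Rightarrow> (nat \<Rightarrow> stk) \<Rightarrow> nat \<Rightarrow> stk" where
  "closing_sub [] t s = s"
| "closing_sub (x # L) t s = closing_sub L t (s(x := sub_stk s (t x)))"

lemma conv_closing_ctx:
  "conv (sub_trm s (fill (closing_ctx L t \<pi> y) M) \<star> \<rho>)
    \<longleftrightarrow> conv (sub_prc (closing_sub L t (s(y := \<rho>))) (M \<star> \<pi>))"
  by (induction L arbitrary: s y \<rho>) (simp_all add: conv_sub_mu)

text \<open>When no \<open>t x\<close> mentions a listed variable, the sequential bindings cannot
  interfere and act simultaneously.\<close>

lemma closing_sub_eq:
  assumes "\<And>x. x \<in> set L \<Longrightarrow> fv_stk (t x) \<inter> set L = {}"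
  shows "closing_sub L t s z = (if z \<in> set L then sub_stk s (t z) else s z)"
  using assms
proof (induction L arbitrary: s)
  case (Cons x L)
  let ?s = "s(x := sub_stk s (t x))"
  have "closing_sub L t ?s z = (if z \<in> set L then sub_stk ?s (t z) else ?s z)"
    using Cons.prems by (intro Cons.IH) auto
  moreover have "sub_stk ?s (t z) = sub_stk s (t z)" if "z \<in> set L"
    using Cons.prems[of z] that by (intro sub_cong(1)) auto
  ultimately show ?case by auto
qed simp

lemma op_equiv_iff: "M \<simeq> N \<longleftrightarrow> eq_trm M N"
proof
  assume "eq_trm M N"
  then have "eq_trm (fill C M) (fill C N)" for C
    using compat_fill[OF compat_obs_theory] by simp
  then show "M \<simeq> N"
    unfolding op_equiv_def has_proper_onf_iff[of _ 0] using eq_trmD by blast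
next
  assume equiv: "M \<simeq> N"
  show "eq_trm M N"
    unfolding eq_trm_def
  proof (intro allI)
    fix s :: "nat \<Rightarrow> stk" and \<pi>
    have fin: "finite (fv_trm M \<union> fv_trm N)"
      by (intro finite_UnI finite_fv)
    then obtain L where L: "set L = fv_trm M \<union> fv_trm N"
      using finite_list by blast
    from fin obtain k where k: "x < k" if "x \<in> set L" for x
      unfolding L finite_nat_set_iff_bounded by blast
    let ?t = "\<lambda>x. ren_stk (\<lambda>y. y + k) (s x)" and ?\<pi> = "ren_stk (\<lambda>y. y + k) \<pi>"
    have cs: "closing_sub L ?t SVar z = (if z \<in> set L then ?t z else SVar z)" for z
    proof -
      have "fv_stk (?t x) \<inter> set L = {}" if "x \<in> set L" for x
        using k by (fastforce simp: fv_ren)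
      from closing_sub_eq[of L ?t SVar z, OF this] show ?thesis by (simp add: sub_SVar)
    qed
    have "has_proper_onf (fill (closing_ctx L ?t ?\<pi> 0) K) \<longleftrightarrow> conv (sub_trm s K \<star> \<pi>)"
      if "fv_trm K \<subseteq> set L" for K
    proof -
      \<comment> \<open>The context binds 0 outermost and is tested on \<open>SVar 0\<close>, so the
        capture of 0 is undone by its argument.\<close>
      have "SVar(0 := SVar 0) = SVar" by auto
      then have "has_proper_onf (fill (closing_ctx L ?t ?\<pi> 0) K)
          \<longleftrightarrow> conv (sub_prc (closing_sub L ?t SVar) (K \<star> ?\<pi>))"
        using conv_closing_ctx[of SVar L ?t ?\<pi> 0 K "SVar 0"]
        by (simp add: has_proper_onf_iff[of _ 0] sub_SVar)
      moreover have "sub_trm (closing_sub L ?t SVar) K = ren_trm (\<lambda>y. y + k) (sub_trm s K)"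
        unfolding ren_sub using that by (intro sub_cong(2)) (auto simp: cs)
      moreover have "sub_stk (closing_sub L ?t SVar) ?\<pi> = sub_stk SVar ?\<pi>"
        using k by (intro sub_cong(1)) (fastforce simp: fv_ren cs)
      ultimately show ?thesis
        using conv_ren_iff[of "\<lambda>y. y + k" "sub_trm s K \<star> \<pi>"] by (simp add: sub_SVar)
    qed
    with L equiv show "conv (sub_trm s M \<star> \<pi>) \<longleftrightarrow> conv (sub_trm s N \<star> \<pi>)"
      unfolding op_equiv_def by blast
  qed
qed

lemma op_theory_eq: "op_theory = obs_theory"
proof (rule set_eqI)
  fix p :: "expr \<times> expr"
  obtain E F where p: "p = (E, F)" by (cases p)
  show "p \<in> op_theory \<longleftrightarrow> p \<in> obs_theory"
    unfolding p by (cases E; cases F)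
      (auto simp: op_theory_def op_equiv_iff eq_trm_mu_iff eq_stk_alt elim: obs_theory.cases)
qed

section \<open>Maximality\<close>

lemma eq_prc_trans: "eq_prc P Q \<Longrightarrow> eq_prc Q R \<Longrightarrow> eq_prc P R"
  by (simp add: eq_prc_def)

lemma eq_trm_if_nf_eq: "nf_trm M = nf_trm N \<Longrightarrow> eq_trm M N"
  using eq_trm_nf[of M] eq_trm_nf[of N] by (simp add: eq_trm_def)

lemma eq_prc_inst: "eq_prc (MuB P \<star> \<pi>) (inst P \<pi>)"
  by (simp add: eq_prc_def sub_inst)

text \<open>By \<open>conv_subD\<close>, no instance of either process converges.\<close>

lemma eq_prc_if_not_conv: "\<not> conv P \<Longrightarrow> \<not> conv Q \<Longrightarrow> eq_prc P Q"
  by (auto simp: eq_prc_def dest: conv_subD)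

lemma conv_head_form: "conv P \<Longrightarrow> \<exists>n x \<rho>. eq_prc P (car_n n (SVar x) \<star> \<rho>)"
proof (induction rule: conv.induct)
  case (Var \<pi> n x \<rho>)
  then have "nf_trm (Car \<pi>) = nf_trm (car_n n (SVar x))"
    using nf_car_n_SVar[of \<pi>] nf_car_n_SVar[of "(Cdr ^^ n) (SVar x)" n x]
    by (simp add: car_n_def)
  from eq_prc_Cut1[OF eq_trm_if_nf_eq[OF this]] show ?case by blast
next
  case (Cons \<pi> M \<pi>' \<rho>)
  from Cons.IH obtain n x \<sigma> where "eq_prc (M \<star> \<rho>) (car_n n (SVar x) \<star> \<sigma>)" by blast
  with eq_prc_Cut1[OF eq_trm_if_nf_eq[OF nf_Car_Cons[OF Cons.hyps(1)]]] show ?case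
    by (intro exI) (rule eq_prc_trans)
next
  case (Mu P \<pi>)
  from Mu.IH obtain n x \<sigma> where "eq_prc (inst P \<pi>) (car_n n (SVar x) \<star> \<sigma>)" by blast
  with eq_prc_inst show ?case by (intro exI) (rule eq_prc_trans)
qed

text \<open>The witness carries \<open>M\<close> at position \<open>n\<close>; the positions before
  it are padded with \<open>M\<close> too.\<close>

lemma ex_stk_component: "\<exists>\<pi>. \<forall>\<rho>. eq_prc (car_n n \<pi> \<star> \<rho>) (M \<star> \<rho>)"
proof (induction n)
  case 0
  show ?case
    by (rule exI[of _ "M ::: SNil"]) (simp add: eq_prc_def sub_car_n conv_car_n_SCons)
next
  case (Suc n)
  then obtain \<pi> where "\<forall>\<rho>. eq_prc (car_n n \<pi> \<star> \<rho>) (M \<star> \<rho>)" by blast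
  then show ?case
    by (intro exI[of _ "M ::: \<pi>"]) (simp add: eq_prc_def sub_car_n conv_car_n_SCons)
qed

section \<open>Theories extending observational equality\<close>

locale extension =
  fixes T :: "expr rel"
  assumes T: "stack_theory T" and obs: "obs_theory \<subseteq> T"
begin

lemma T_compat: "(E, F) \<in> compat T \<Longrightarrow> (E, F) \<in> T"
  using T by (auto simp: stack_theory_def)

lemmas T_mu = T_compat[OF compat.mu[OF compat.base]]
  and T_Cut1 = T_compat[OF compat.Cut1[OF compat.base]]
  and T_Cut2 = T_compat[OF compat.Cut2[OF compat.base]]

lemma T_sym: "(E, F) \<in> T \<Longrightarrow> (F, E) \<in> T"
  and T_trans: "(E, F) \<in> T \<Longrightarrow> (F, G) \<in> T \<Longrightarrow> (E, G) \<in> T"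
  using T unfolding stack_theory_def equiv_def by (auto dest: symD transD)

lemma T_prc: "eq_prc P Q \<Longrightarrow> (Prc P, Prc Q) \<in> T"
  using obs by auto

text \<open>Substitution is simulated by congruence: abstract \<open>x\<close> on both sides, apply
  to \<open>\<pi>\<close> and contract.\<close>

lemma T_subst:
  assumes "(Prc P, Prc Q) \<in> T"
  shows "(Prc (subst P \<pi> x), Prc (subst Q \<pi> x)) \<in> T"
proof -
  have beta: "eq_prc (mu x P \<star> \<pi>) (subst P \<pi> x)" for P
    using eq_prc_inst by (simp add: mu_def flip: inst_bind)
  have "(Prc (mu x P \<star> \<pi>), Prc (mu x Q \<star> \<pi>)) \<in> T"
    using assms by (intro T_Cut1 T_mu)
  from T_trans[OF T_sym[OF T_prc[OF beta]] T_trans[OF this T_prc[OF beta]]] show ?thesis .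
qed

lemma inconsistent_if_conv_eq_not_conv:
  assumes PQ: "(Prc P, Prc Q) \<in> T" and "conv P" and "\<not> conv Q"
  shows "inconsistent T"
proof -
  obtain n x \<rho> where "eq_prc P (car_n n (SVar x) \<star> \<rho>)"
    using conv_head_form[OF \<open>conv P\<close>] by blast
  then have head: "(Prc (car_n n (SVar x) \<star> \<rho>), Prc Q) \<in> T"
    by (rule T_trans[OF T_sym[OF T_prc] PQ])
  have collapse: "(Prc R, Prc Q) \<in> T" for R
  proof -
    \<comment> \<open>\<open>MuB (ren_prc Suc R)\<close> is the constant function: it discards its
      argument and continues as \<open>R\<close>.\<close>
    obtain \<pi> where \<pi>: "eq_prc (car_n n \<pi> \<star> \<sigma>) (MuB (ren_prc Suc R) \<star> \<sigma>)" for \<sigma>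
      using ex_stk_component by blast
    from T_subst[OF head, of \<pi> x]
    have "(Prc (car_n n \<pi> \<star> sub_stk (SVar(x := \<pi>)) \<rho>), Prc (subst Q \<pi> x)) \<in> T"
      by (simp add: subst_def sub_car_n)
    moreover have "eq_prc (car_n n \<pi> \<star> sub_stk (SVar(x := \<pi>)) \<rho>) R"
      using eq_prc_trans[OF \<pi> eq_prc_inst] by simp
    moreover have "eq_prc (subst Q \<pi> x) Q"
      using \<open>\<not> conv Q\<close> by (intro eq_prc_if_not_conv) (auto simp: subst_def dest: conv_subD)
    ultimately show ?thesis
      by (blast intro: T_trans[OF T_sym[OF T_prc] T_trans[OF _ T_prc]])
  qed
  show ?thesis
    unfolding inconsistent_def
  proof (intro allI impI)
    fix M N \<gamma>
    have "(Prc (M \<star> SVar \<gamma>), Prc (N \<star> SVar \<gamma>)) \<in> T"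
      by (rule T_trans[OF collapse T_sym[OF collapse]])
    then show "(Trm (mu \<gamma> (M \<star> SVar \<gamma>)), Trm (mu \<gamma> (N \<star> SVar \<gamma>))) \<in> T"
      by (rule T_mu)
  qed
qed

text \<open>A separating head context turns the equation into one between a convergent and a
  divergent process.\<close>

lemma inconsistent_if_not_eq_trm:
  assumes MN: "(Trm M, Trm N) \<in> T" and "\<not> eq_trm M N"
  shows "inconsistent T"
proof -
  from \<open>\<not> eq_trm M N\<close> obtain C where "has_proper_onf (fill C M) \<noteq> has_proper_onf (fill C N)"
    unfolding op_equiv_iff[symmetric] op_equiv_def by blast
  then have neq: "conv (fill C M \<star> SVar 0) \<noteq> conv (fill C N \<star> SVar 0)"
    by (simp add: has_proper_onf_iff[of _ 0])
  have "(Trm (fill C M), Trm (fill C N)) \<in> T"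
    using T by (intro compat_fill[OF _ MN]) (simp add: stack_theory_def)
  then have "(Prc (fill C M \<star> SVar 0), Prc (fill C N \<star> SVar 0)) \<in> T"
    by (rule T_Cut1)
  with neq show ?thesis using inconsistent_if_conv_eq_not_conv T_sym by metis
qed

text \<open>New equations of every sort reduce to equations between terms: processes are abstracted,
  and stacks are first cut against a term that tells them apart.\<close>

lemma inconsistent_if_proper:
  assumes "obs_theory \<noteq> T"
  shows "inconsistent T"
proof -
  obtain E F where EF: "(E, F) \<in> T" "(E, F) \<notin> obs_theory" using assms obs by auto
  have prc: "inconsistent T" if "(Prc P, Prc Q) \<in> T" "\<not> eq_prc P Q" for P Q
    using that by (intro inconsistent_if_not_eq_trm[of "mu 0 P" "mu 0 Q"])
      (auto simp: eq_trm_mu_iff intro: T_mu)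
  have "(E, F) \<in> range Stk \<times> range Stk \<union> range Trm \<times> range Trm \<union> range Prc \<times> range Prc"
    using EF T by (auto simp: stack_theory_def well_sorted_def)
  then consider \<pi> \<rho> where "E = Stk \<pi>" "F = Stk \<rho>" | M N where "E = Trm M" "F = Trm N"
    | P Q where "E = Prc P" "F = Prc Q" by blast
  then show ?thesis
  proof cases
    case 1
    with EF obtain M where "\<not> eq_prc (M \<star> \<pi>) (M \<star> \<rho>)" by (auto simp: eq_stk_alt)
    with EF 1 show ?thesis by (intro prc[of "M \<star> \<pi>" "M \<star> \<rho>"] T_Cut2) auto
  qed (use EF prc inconsistent_if_not_eq_trm in auto)
qed

end

lemma consistent_obs_theory: "\<not> inconsistent obs_theory"
proof
  assume "inconsistent obs_theory"
  \<comment> \<open>A variable head is set against a \<open>SNil\<close> head; index 1 is fresh for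
    both, and only the first body converges.\<close>
  then have "eq_trm (mu 1 (Car (SVar 0) \<star> SVar 1)) (mu 1 (Car SNil \<star> SVar 1))"
    unfolding inconsistent_def by simp
  then have "conv (sub_prc SVar (Car (SVar 0) \<star> SVar 1)) \<longleftrightarrow> conv (sub_prc SVar (Car SNil \<star> SVar 1))"
    unfolding eq_trm_mu_iff eq_prc_def by blast
  moreover have "conv (Car (SVar 0) \<star> SVar 1)"
    by (rule conv.Var[of _ 0 0]) simp
  moreover have "\<not> conv (Car SNil \<star> SVar 1)"
    by (rule conv_Nil[of _ 0]) simp
  ultimately show False by simp
qed

theorem theorem3: "hilbert_post_complete op_theory"
  unfolding hilbert_post_complete_def op_theory_eq
  using stack_theory_obs_theory consistent_obs_theory extension.inconsistent_if_proper
  by (auto simp: extension_def)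

end
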